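(* Let $\mathbb{F}$ be an algebraically closed field of characteristic zero and $J_1=E_{12}$. Let $\underline{A}=(J_1,A_2,A_3)$ and $\underline{B}=(0,B_2,B_3)$ be elements of $\mathcal{N}_3^3$ such that $f(\underline{A})=f(\underline{B})$ for all $f\in S_{3,3}$. Then $f(\underline{A})=f(\underline{B})$ for all $f\in P_{3,3}$.
   Context: $E_{ij}$ is the $3\times3$ matrix unit. $\mathcal{N}_3^3$ is the set of triples of nilpotent $3\times3$ matrices over $\mathbb{F}$. $\mathrm{tr}(Y_{i_1}\cdots Y_{i_r})$ denotes the function $\underline{A}\mapsto\mathrm{tr}(A_{i_1}\cdots A_{i_r})$. $S_{3,3}$ is the set consisting of: $\mathrm{tr}(Y_iY_j),\ \mathrm{tr}(Y_i^2Y_j),\ \mathrm{tr}(Y_iY_j^2),\ \mathrm{tr}(Y_i^2Y_j^2),\ \mathrm{tr}(Y_i^2Y_j^2Y_iY_j)$ for $1\le i<j\le3$; $\mathrm{tr}(Y_1Y_2Y_3)$, $\mathrm{tr}(Y_1Y_3Y_2)$; $\mathrm{tr}(Y_i^2Y_jY_k)$ for $\{i,j,k\}=\{1,2,3\}$; $\mathrm{tr}(Y_1^2Y_2Y_1Y_3)$, $\mathrm{tr}(Y_2^2Y_1Y_2Y_3)$, $\mathrm{tr}(Y_3^2Y_1Y_3Y_2)$. $P_{3,3}=S_{3,3}\sqcup P'_{3,3}$, where $P'_{3,3}$ consists of $\mathrm{tr}(Y_i^2Y_j^2Y_k)$ and $\mathrm{tr}(Y_i^2Y_j^2Y_iY_k)$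 for $\{i,j,k\}=\{1,2,3\}$, and $\mathrm{tr}(Y_1^2Y_2^2Y_3^2)$. *)

theory Defs
  imports "HOL-Analysis.Analysis" "HOL-Computational_Algebra.Polynomial"
begin

type_synonym 'a mat3 = "'a^3^3"

text \<open>Matrix unit E_ij (indices 1,2,3 as elements of the numeral type 3).\<close>
definition matunit :: "3 \<Rightarrow> 3 \<Rightarrow> 'a::semiring_1 mat3" where
  "matunit p q = (\<chi> i j. if i = p \<and> j = q then 1 else 0)"

text \<open>Nilpotent matrix: some power is zero.\<close>
definition nilpotent_mat :: "'a::semiring_1 mat3 \<Rightarrow> bool" where
  "nilpotent_mat A \<longleftrightarrow> (\<exists>k::nat. (((**) A) ^^ k) (mat 1) = 0)"

text \<open>A triple (A1,A2,A3) viewed as the map i \<mapsto> A_i (i = 1,2,3).\<close>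
definition triple :: "'a mat3 \<Rightarrow> 'a mat3 \<Rightarrow> 'a mat3 \<Rightarrow> nat \<Rightarrow> 'a mat3" where
  "triple X1 X2 X3 i = (if i = 1 then X1 else if i = 2 then X2 else X3)"

text \<open>The trace function tr(Y_{i1}...Y_{ir}) given by the word [i1,...,ir],
  evaluated at the triple T.\<close>
definition trw :: "(nat \<Rightarrow> 'a::comm_semiring_1 mat3) \<Rightarrow> nat list \<Rightarrow> 'a" where
  "trw T w = trace (foldr (\<lambda>i M. T i ** M) w (mat 1))"

definition S33 :: "nat list set" where
  "S33 =
     {w. \<exists>i j. 1 \<le> i \<and> i < j \<and> j \<le> 3 \<and>
        (w = [i,j] \<or> w = [i,i,j] \<or> w = [i,j,j] \<or> w = [i,i,j,j] \<or> w = [i,i,j,j,i,j])}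
   \<union> {[1,2,3], [1,3,2]}
   \<union> {[i,i,j,k] | i j k. {i,j,k} = {1,2,3::nat}}
   \<union> {[1,1,2,1,3], [2,2,1,2,3], [3,3,1,3,2]}"

definition P33' :: "nat list set" where
  "P33' =
     {[i,i,j,j,k] | i j k. {i,j,k} = {1,2,3::nat}}
   \<union> {[i,i,j,j,i,k] | i j k. {i,j,k} = {1,2,3::nat}}
   \<union> {[1,1,2,2,3,3]}"

definition P33 :: "nat list set" where
  "P33 = S33 \<union> P33'"

end

theory Submission
  imports Defs
begin

(* Every word of P'_{3,3} contains Y1, so it vanishes at B, where B1 = 0; for the same reason the
   hypotheses say that tr(E12 M) = M21 vanishes for M = A2, A3, A2^2, A3^2, A2 A3, A3 A2.
   At A, words containing Y1 Y1 vanish because E12^2 = 0, and the remaining ones are, up to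
   cyclic rotation, (Ai^2 Aj^2)_21 and (Ai^2 Aj^2 Ai)_21.  A nilpotent 3x3 matrix has vanishing
   trace, sum of principal 2-minors and determinant (det(1 - tX) is a nowhere vanishing
   polynomial over an algebraically closed field); together with X21 = (X^2)_21 = 0 this forces
   the first columns of X^2 and of Y^2 X to vanish, which kills both entries. *)

lemma matrix_diff_rdistrib:
  fixes A B :: "'a::comm_ring_1^'n^'m" and C :: "'a^'p^'n"
  shows "(A - B) ** C = A ** C - B ** C"
  by (vector matrix_matrix_mult_def sum_subtractf algebra_simps)

lemma matrix_mul_mat_nth: "((A::'a::semiring_1^'n^'m) ** mat c)$i$j = A$i$j * c"
  unfolding matrix_matrix_mult_def mat_def
  by (simp add: if_distrib if_distribR sum.delta'[OF finite] cong: if_cong)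

lemma mat_matrix_mul_nth: "(mat c ** (A::'a::semiring_1^'n^'m))$i$j = c * A$i$j"
  unfolding matrix_matrix_mult_def mat_def
  by (simp add: if_distrib if_distribR sum.delta[OF finite] cong: if_cong)

lemma mat_matrix_mul_commute: "(A::'a::comm_semiring_1^'n^'n) ** mat c = mat c ** A"
  by (simp add: vec_eq_iff matrix_mul_mat_nth mat_matrix_mul_nth mult.commute)

lemma mat_mult_mat: "mat c ** mat d = (mat (c * d) :: 'a::semiring_1^'n^'n)"
  unfolding vec_eq_iff mat_matrix_mul_nth by (simp add: mat_def)

lemma matrix_geometric_sum:
  fixes A :: "'a::comm_ring_1^'n^'n"
  shows "(mat 1 - mat t ** A) ** (\<Sum>i<k. mat (t ^ i) ** ((**) A ^^ i) (mat 1))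
           = mat 1 - mat (t ^ k) ** ((**) A ^^ k) (mat 1)"
proof (induction k)
  case 0
  show ?case by simp
next
  case (Suc k)
  let ?M = "((**) A ^^ k) (mat 1)"
  have "(mat t ** A) ** (mat (t ^ k) ** ?M) = mat t ** ((A ** mat (t ^ k)) ** ?M)"
    by (simp only: matrix_mul_assoc)
  also have "\<dots> = (mat t ** mat (t ^ k)) ** (A ** ?M)"
    by (simp only: mat_matrix_mul_commute[of A] matrix_mul_assoc)
  also have "\<dots> = mat (t ^ Suc k) ** (A ** ?M)"
    by (simp only: mat_mult_mat power_Suc)
  finally have "(mat 1 - mat t ** A) ** (mat (t ^ k) ** ?M)
      = mat (t ^ k) ** ?M - mat (t ^ Suc k) ** (A ** ?M)"
    by (simp only: matrix_diff_rdistrib matrix_mul_lid)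
  then show ?case
    using Suc.IH by (simp only: sum.lessThan_Suc matrix_add_ldistrib funpow.simps comp_def) simp
qed

lemma det_one_minus_nilpotent_nonzero:
  fixes A :: "'a::field^'n^'n"
  assumes "((**) A ^^ k) (mat 1) = 0"
  shows "det (mat 1 - mat t ** A) \<noteq> 0"
proof -
  have "det (mat 1 - mat t ** A) * det (\<Sum>i<k. mat (t ^ i) ** ((**) A ^^ i) (mat 1)) = 1"
    using assms matrix_geometric_sum[of t A k] by (simp add: det_mul[symmetric])
  then show ?thesis by auto
qed

lemma alg_closed_poly_no_root_imp_degree_0:
  fixes p :: "'a::alg_closed_field poly"
  assumes "\<And>x. poly p x \<noteq> 0"
  shows "degree p = 0"
  using alg_closed_imp_poly_has_root[of p] assms by auto

lemma mat3_mult_nth: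
  "((A::'a::comm_semiring_1 mat3) ** B)$i$j = A$i$1 * B$1$j + A$i$2 * B$2$j + A$i$3 * B$3$j"
  by (simp add: matrix_matrix_mult_def sum_3)

definition principal_minor_sum :: "'a::comm_ring_1 mat3 \<Rightarrow> 'a" where
  "principal_minor_sum A =
     A$1$1 * A$2$2 - A$1$2 * A$2$1 + A$1$1 * A$3$3 - A$1$3 * A$3$1 + A$2$2 * A$3$3 - A$2$3 * A$3$2"

lemma det_one_minus_mat3:
  fixes A :: "'a::comm_ring_1 mat3"
  shows "det (mat 1 - mat t ** A) = poly [:1, - trace A, principal_minor_sum A, - det A:] t"
  by (simp add: det_3 mat3_mult_nth mat_def trace_def sum_3 principal_minor_sum_def algebra_simps)

lemma nilpotent_mat3_invariants:
  fixes A :: "'a::alg_closed_field mat3"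
  assumes "nilpotent_mat A"
  shows "trace A = 0" "principal_minor_sum A = 0" "det A = 0"
proof -
  let ?p = "[:1, - trace A, principal_minor_sum A, - det A:]"
  obtain k where "((**) A ^^ k) (mat 1) = 0"
    using assms unfolding nilpotent_mat_def by blast
  then have "degree ?p = 0"
    by (metis alg_closed_poly_no_root_imp_degree_0 det_one_minus_mat3
        det_one_minus_nilpotent_nonzero)
  then have "coeff ?p n = 0" if "n > 0" for n
    using that by (simp add: coeff_eq_0)
  from this[of 1] this[of 2] this[of 3] show "trace A = 0" "principal_minor_sum A = 0" "det A = 0"
    by (simp_all add: numeral_eq_Suc)
qed

lemma nilpotent_mat3_nth_1_1:
  fixes X :: "'a::alg_closed_field mat3"
  assumes "nilpotent_mat X" "X$2$1 = 0" "X$3$1 = 0"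
  shows "X$1$1 = 0"
proof -
  have "(X$1$1) ^ 3 = 0"
    using assms(2,3) nilpotent_mat3_invariants[OF assms(1)]
    unfolding trace_def sum_3 principal_minor_sum_def det_3 by algebra
  then show ?thesis by simp
qed

lemma nilpotent_mat3_square_nth:
  fixes Y :: "'a::alg_closed_field mat3"
  assumes "nilpotent_mat Y" "Y$2$1 = 0" "Y$2$3 = 0" "j \<noteq> 2"
  shows "(Y ** Y)$i$j = 0"
proof -
  note invariants = nilpotent_mat3_invariants[OF assms(1)]
  \<comment> \<open>Row 2 of Y is (0, Y22, 0): Y22 is an eigenvalue, and the {1,3}-block is a nilpotent
    2x2 matrix, whose square vanishes by Cayley-Hamilton.\<close>
  have "(Y$2$2) ^ 3 = 0"
    using assms(2,3) invariants unfolding trace_def sum_3 principal_minor_sum_def det_3 by algebra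
  then have "Y$2$2 = 0" by simp
  then have "Y$1$1 + Y$3$3 = 0" "Y$1$1 * Y$3$3 - Y$1$3 * Y$3$1 = 0"
    using assms invariants unfolding trace_def sum_3 principal_minor_sum_def by simp_all
  then have "(Y ** Y)$1$1 = 0" "(Y ** Y)$1$3 = 0" "(Y ** Y)$3$1 = 0" "(Y ** Y)$3$3 = 0"
    using assms(2,3) unfolding mat3_mult_nth by algebra+
  moreover have "(Y ** Y)$2$1 = 0" "(Y ** Y)$2$3 = 0"
    using assms(2,3) by (simp_all add: mat3_mult_nth)
  ultimately show ?thesis
    using assms(4) exhaust_3[of i] exhaust_3[of j] by auto
qed

lemma nilpotent_mat3_square_nth_1:
  fixes X :: "'a::alg_closed_field mat3"
  assumes "nilpotent_mat X" "X$2$1 = 0" "(X ** X)$2$1 = 0"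
  shows "(X ** X)$i$1 = 0"
proof (cases "X$3$1 = 0")
  case True
  with assms have "X$1$1 = 0"
    using nilpotent_mat3_nth_1_1 by blast
  with True assms(2) show ?thesis
    by (simp add: mat3_mult_nth)
next
  case False
  have "X$2$3 * X$3$1 = 0"
    using assms(2,3) by (simp add: mat3_mult_nth)
  with False have "X$2$3 = 0" by simp
  show ?thesis
    by (rule nilpotent_mat3_square_nth[OF assms(1,2) \<open>X$2$3 = 0\<close>]) simp
qed

lemma nilpotent_mat3_square_mult_nth_1:
  fixes X Y :: "'a::alg_closed_field mat3"
  assumes "nilpotent_mat Y" "Y$2$1 = 0" "(Y ** Y)$2$1 = 0" "X$2$1 = 0" "(Y ** X)$2$1 = 0"
  shows "((Y ** Y) ** X)$i$1 = 0"
proof (cases "X$3$1 = 0")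
  case True
  with assms(4) show ?thesis
    using nilpotent_mat3_square_nth_1[OF assms(1-3)] by (simp add: mat3_mult_nth[of "Y ** Y"])
next
  case False
  have "Y$2$3 * X$3$1 = 0"
    using assms(2,4,5) by (simp add: mat3_mult_nth)
  with False have "Y$2$3 = 0" by simp
  then have "(Y ** Y)$i$1 = 0" "(Y ** Y)$i$3 = 0"
    using nilpotent_mat3_square_nth[OF assms(1,2)] by simp_all
  with assms(4) show ?thesis
    by (simp add: mat3_mult_nth[of "Y ** Y"])
qed

lemma nilpotent_mat3_square_products_nth_2_1:
  fixes X Y :: "'a::alg_closed_field mat3"
  assumes "nilpotent_mat X" "nilpotent_mat Y"
    and "X$2$1 = 0" "(X ** X)$2$1 = 0" "Y$2$1 = 0" "(Y ** Y)$2$1 = 0" "(Y ** X)$2$1 = 0"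
  shows "((X ** X) ** (Y ** Y))$2$1 = 0" "((X ** X) ** ((Y ** Y) ** X))$2$1 = 0"
  using nilpotent_mat3_square_nth_1[OF assms(2,5,6)]
    nilpotent_mat3_square_mult_nth_1[OF assms(2,5,6,3,7)]
  by (simp_all add: mat3_mult_nth[of "X ** X"])

definition word_prod :: "(nat \<Rightarrow> 'a::semiring_1 mat3) \<Rightarrow> nat list \<Rightarrow> 'a mat3" where
  "word_prod T w = foldr (\<lambda>i M. T i ** M) w (mat 1)"

lemma word_prod_simps [simp]:
  "word_prod T [] = mat 1"
  "word_prod T (i # w) = T i ** word_prod T w"
  by (simp_all add: word_prod_def)

lemma trw_eq_trace_word_prod: "trw T w = trace (word_prod T w)"
  by (simp add: trw_def word_prod_def)

lemma word_prod_eq_0_if_mem: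
  assumes "T i = 0" "i \<in> set w"
  shows "word_prod T w = 0"
  using assms(2) by (induction w) (auto simp: assms(1))

lemma trw_eq_0_if_mem:
  assumes "T i = 0" "i \<in> set w"
  shows "trw T w = 0"
  using word_prod_eq_0_if_mem[of T i w, OF assms] by (simp add: trw_eq_trace_word_prod trace_def)

lemma matunit12_mult_nth:
  "(matunit 1 2 ** (M::'a::comm_semiring_1 mat3))$i$j = (if i = 1 then M$2$j else 0)"
  by (simp add: mat3_mult_nth matunit_def)

lemma trace_matunit12_mult: "trace (matunit 1 2 ** (M::'a::comm_semiring_1 mat3)) = M$2$1"
  by (simp add: trace_def sum_3 matunit12_mult_nth)

lemma trace_mult_matunit12: "trace ((M::'a::comm_semiring_1 mat3) ** matunit 1 2) = M$2$1"
  by (subst trace_mul_sym) (rule trace_matunit12_mult)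

lemma matunit12_square: "matunit 1 2 ** matunit 1 2 = (0::'a::comm_semiring_1 mat3)"
  unfolding vec_eq_iff matunit12_mult_nth by (simp add: matunit_def)

lemma mult_matunit12_square: "(M ** matunit 1 2) ** matunit 1 2 = (0::'a::comm_semiring_1 mat3)"
  by (simp add: matrix_mul_assoc[symmetric] matunit12_square)

lemma trw_triple_matunit12_Cons_1:
  "trw (triple (matunit 1 2) X Y) (1 # w) = (word_prod (triple (matunit 1 2) X Y) w)$2$1"
  by (simp add: trw_eq_trace_word_prod triple_def trace_matunit12_mult)

lemma insert3_eq_123_iff:
  "{i, j, k} = {1, 2, 3::nat} \<longleftrightarrow>
     (i, j, k) \<in> {(1,2,3), (1,3,2), (2,1,3), (2,3,1), (3,1,2), (3,2,1)}"
proof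
  assume eq: "{i, j, k} = {1, 2, 3::nat}"
  then have "i = 1 \<or> i = 2 \<or> i = 3" "j = 1 \<or> j = 2 \<or> j = 3" "k = 1 \<or> k = 2 \<or> k = 3"
    by blast+
  moreover have "1 \<in> {i,j,k}" "2 \<in> {i,j,k}" "3 \<in> {i,j,k}"
    using eq by blast+
  ultimately show "(i, j, k) \<in> {(1,2,3), (1,3,2), (2,1,3), (2,3,1), (3,1,2), (3,2,1)}"
    by (elim disjE) simp_all
qed auto

lemma P33'_eq:
  "P33' = {[1,1,2,2,3], [1,1,3,3,2], [2,2,1,1,3], [2,2,3,3,1], [3,3,1,1,2], [3,3,2,2,1],
           [1,1,2,2,1,3], [1,1,3,3,1,2], [2,2,1,1,2,3], [2,2,3,3,2,1], [3,3,1,1,3,2],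
           [3,3,2,2,3,1], [1,1,2,2,3,3]}"
  unfolding P33'_def insert3_eq_123_iff by auto

lemma S33_mem:
  "[1,2] \<in> S33" "[1,3] \<in> S33" "[1,2,2] \<in> S33" "[1,3,3] \<in> S33"
  "[1,2,3] \<in> S33" "[1,3,2] \<in> S33"
  unfolding S33_def by auto

lemma trw_triple_matunit12_P33'_eq_0:
  fixes X Y :: "'a::alg_closed_field mat3"
  assumes "nilpotent_mat X" "nilpotent_mat Y"
    and S33_vanish:
      "\<And>w. w \<in> S33 \<Longrightarrow> 1 \<in> set w \<Longrightarrow> trw (triple (matunit 1 2) X Y) w = 0"
    and "w \<in> P33'"
  shows "trw (triple (matunit 1 2) X Y) w = 0"
proof -
  have "X$2$1 = 0" "Y$2$1 = 0" "(X ** X)$2$1 = 0" "(Y ** Y)$2$1 = 0"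
    and "(X ** Y)$2$1 = 0" "(Y ** X)$2$1 = 0"
    using S33_vanish[OF S33_mem(1)] S33_vanish[OF S33_mem(2)] S33_vanish[OF S33_mem(3)]
      S33_vanish[OF S33_mem(4)] S33_vanish[OF S33_mem(5)] S33_vanish[OF S33_mem(6)]
    unfolding trw_triple_matunit12_Cons_1 by (simp_all add: triple_def)
  then have "((X ** X) ** (Y ** Y))$2$1 = 0" "((X ** X) ** ((Y ** Y) ** X))$2$1 = 0"
    "((Y ** Y) ** (X ** X))$2$1 = 0" "((Y ** Y) ** ((X ** X) ** Y))$2$1 = 0"
    using nilpotent_mat3_square_products_nth_2_1[OF assms(1,2)]
      nilpotent_mat3_square_products_nth_2_1[OF assms(2,1)] by simp_all
  with assms(4) show ?thesis
    unfolding P33'_eq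
    by (auto simp: trw_eq_trace_word_prod triple_def matrix_mul_assoc trace_mult_matunit12
        matunit12_square mult_matunit12_square trace_0[unfolded mat_0])
qed

theorem lemma8p1:
  fixes A2 A3 B2 B3 :: "'a::{alg_closed_field, field_char_0} mat3"
  assumes "nilpotent_mat (matunit 1 2 :: 'a mat3)"
    and "nilpotent_mat A2" and "nilpotent_mat A3"
    and "nilpotent_mat (0 :: 'a mat3)"
    and "nilpotent_mat B2" and "nilpotent_mat B3"
    and "\<forall>w\<in>S33. trw (triple (matunit 1 2) A2 A3) w = trw (triple 0 B2 B3) w"
  shows "\<forall>w\<in>P33. trw (triple (matunit 1 2) A2 A3) w = trw (triple 0 B2 B3) w"
proof -
  have B_vanish: "trw (triple 0 B2 B3) w = 0" if "1 \<in> set w" for w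
    by (rule trw_eq_0_if_mem[OF _ that]) (simp add: triple_def)
  then have "trw (triple (matunit 1 2) A2 A3) w = 0" if "w \<in> S33" "1 \<in> set w" for w
    using assms(7) that by simp
  then have "trw (triple (matunit 1 2) A2 A3) w = 0" if "w \<in> P33'" for w
    using trw_triple_matunit12_P33'_eq_0[OF assms(2,3)] that by blast
  moreover have "1 \<in> set w" if "w \<in> P33'" for w
    using that unfolding P33'_eq by auto
  ultimately show ?thesis
    using assms(7) B_vanish unfolding P33_def by auto
qed

end
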